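(* Let $\alpha\in(0,1)$, $c\ge 1/4$ and $m\in[0,1]$. Suppose the observations $X_1,X_2,\dots$ are drawn i.i.d. from a probability distribution $P$ on $[0,1]$ whose mean is $\mu=m$. Let $T_t(m,\alpha)$ be the sequential capital process test for the null hypothesis $m$. Then $$\mathbb{P}\big(\exists t\in\mathbb{N}:\ T_t(m,\alpha)=1\big)\le \alpha .$$
   Context: Single data stream: $X_1,X_2,\dots\in[0,1]$. For $m\in[0,1]$ and a constant $c\ge 1/4$, put $\hat\mu_0=m$ and $\hat\mu_{i-1}=\frac{1}{i-1}\sum_{j=1}^{i-1}X_j$ for $i>1$. The capital process is $$K_t(m)=\prod_{i=1}^t\left(1+\frac{(\hat\mu_{i-1}-m)(X_i-m)}{c}\right).$$ The sequential capital process test is $T_t(m,\alpha)=\mathbf{1}\left[\max_{1\le i\le t}K_i(m)\ge 1/\alpha\right]$; the value $1$ means rejection of the null hypothesis that the mean of the distribution is $m$. *)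

theory Defs
  imports "HOL-Probability.Probability"
begin

text \<open>
  A data stream is a function \<open>x :: nat \<Rightarrow> real\<close>, read at the indices \<open>1, 2, \<dots>\<close> only;
  the value \<open>x 0\<close> is never used.
\<close>

definition running_mean :: "real \<Rightarrow> (nat \<Rightarrow> real) \<Rightarrow> nat \<Rightarrow> real" where
  "running_mean m x k = (if k = 0 then m else (\<Sum>j=1..k. x j) / real k)"

definition capital :: "real \<Rightarrow> real \<Rightarrow> (nat \<Rightarrow> real) \<Rightarrow> nat \<Rightarrow> real" where
  "capital c m x t = (\<Prod>i=1..t. 1 + (running_mean m x (i - 1) - m) * (x i - m) / c)"

text \<open>The test is meant for \<open>t \<ge> 1\<close>: at \<open>t = 0\<close> the maximum would range over the empty set.\<close>

definition capital_test :: "real \<Rightarrow> real \<Rightarrow> real \<Rightarrow> (nat \<Rightarrow> real) \<Rightarrow> nat \<Rightarrow> nat" where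
  "capital_test c m \<alpha> x t = of_bool (Max ((\<lambda>i. capital c m x i) ` {1..t}) \<ge> 1 / \<alpha>)"

end

theory Submission
  imports Defs
begin

text \<open>
  Freezing the capital as soon as it reaches \<open>1 / \<alpha>\<close> turns each step into adding a predictable
  quantity times \<open>X\<^sub>i - m\<close>, which has mean zero and is independent of the past; so the
  frozen capital has expectation \<open>1\<close> at every time. It is nonnegative because
  \<open>(\<mu> - m) (x - m) \<ge> - m (1 - m) \<ge> - 1 / 4\<close> for \<open>\<mu>, x, m \<in> [0, 1]\<close>. At time \<open>t\<close> it is at least
  \<open>1 / \<alpha>\<close> exactly if the test has rejected by then, hence Markov's inequality bounds that
  probability by \<open>\<alpha>\<close> for each \<open>t\<close>, and the limit \<open>t \<rightarrow> \<infinity>\<close> of increasing events gives the claim.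
\<close>

section \<open>The stopped capital and its dependence on the past\<close>

primrec stopped_capital :: "real \<Rightarrow> real \<Rightarrow> real \<Rightarrow> (nat \<Rightarrow> real) \<Rightarrow> nat \<Rightarrow> real" where
  "stopped_capital c m a x 0 = 1"
| "stopped_capital c m a x (Suc n) =
    (if a \<le> stopped_capital c m a x n then stopped_capital c m a x n
     else stopped_capital c m a x n * (1 + (running_mean m x n - m) * (x (Suc n) - m) / c))"

text \<open>The predictable factor of \<open>x (Suc n) - m\<close> in one step: it reads only
  \<open>x 1\<close>, ..., \<open>x n\<close>, and it vanishes once the level \<open>a\<close> is
  reached.\<close>

definition stopped_bet :: "real \<Rightarrow> real \<Rightarrow> real \<Rightarrow> (nat \<Rightarrow> real) \<Rightarrow> nat \<Rightarrow> real" where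
  "stopped_bet c m a x n =
    (if a \<le> stopped_capital c m a x n then 0
     else stopped_capital c m a x n * (running_mean m x n - m) / c)"

lemma stopped_capital_Suc_eq:
  "stopped_capital c m a x (Suc n) =
    stopped_capital c m a x n + stopped_bet c m a x n * (x (Suc n) - m)"
  by (simp add: stopped_bet_def distrib_left mult.assoc)

lemma running_mean_cong:
  assumes "\<And>i. 1 \<le> i \<Longrightarrow> i \<le> n \<Longrightarrow> x i = y i"
  shows "running_mean m x n = running_mean m y n"
  unfolding running_mean_def using assms by (auto intro!: sum.cong)

lemma stopped_capital_cong:
  assumes "\<And>i. 1 \<le> i \<Longrightarrow> i \<le> n \<Longrightarrow> x i = y i"
  shows "stopped_capital c m a x n = stopped_capital c m a y n"
  using assms
proof (induction n)
  case (Suc n)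
  moreover have "running_mean m x n = running_mean m y n"
    by (rule running_mean_cong) (use Suc.prems in auto)
  ultimately show ?case by simp
qed simp

section \<open>Bounds for observations in the unit interval\<close>

lemma running_mean_in_unit_interval:
  assumes "m \<in> {0..1}" and "\<And>i. 1 \<le> i \<Longrightarrow> x i \<in> {0..1}"
  shows "running_mean m x n \<in> {0..1}"
proof -
  have "0 \<le> (\<Sum>j=1..n. x j)"
    using assms(2) by (intro sum_nonneg) auto
  moreover have "(\<Sum>j=1..n. x j) \<le> (\<Sum>j=1..n. 1)"
    using assms(2) by (intro sum_mono) auto
  ultimately show ?thesis
    using assms(1) by (auto simp: running_mean_def divide_le_eq)
qed

text \<open>Only deviations of opposite sign matter: then one distance to \<open>m\<close> is at
  most \<open>m\<close> and the other at most \<open>1 - m\<close>.\<close>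

lemma deviation_product_ge:
  fixes u v m :: real
  assumes "m \<in> {0..1}" "u \<in> {0..1}" "v \<in> {0..1}"
  shows "- (1 / 4) \<le> (u - m) * (v - m)"
proof -
  have quarter: "m * (1 - m) \<le> 1 / 4"
    using zero_le_power2[of "m - 1 / 2"] by (simp add: power2_eq_square algebra_simps)
  consider "u \<le> m" "m \<le> v" | "m \<le> u" "v \<le> m" | "0 \<le> (u - m) * (v - m)"
    by (metis diff_ge_0_iff_ge linear mult_nonneg_nonneg mult_nonpos_nonpos diff_le_0_iff_le)
  then show ?thesis
  proof cases
    case 1
    then have "(m - u) * (v - m) \<le> m * (1 - m)"
      using assms by (intro mult_mono) auto
    with quarter show ?thesis by (simp add: algebra_simps)
  next
    case 2
    then have "(m - v) * (u - m) \<le> m * (1 - m)"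
      using assms by (intro mult_mono) auto
    with quarter show ?thesis by (simp add: algebra_simps)
  qed auto
qed

text \<open>The lower bound keeps the capital nonnegative. The upper one is crude, from deviations
  of modulus at most 1 and \<open>1 / c \<le> 4\<close>; it serves integrability.\<close>

lemma capital_factor_bounds:
  fixes c m u v :: real
  assumes "c \<ge> 1 / 4" "m \<in> {0..1}" "u \<in> {0..1}" "v \<in> {0..1}"
  shows "0 \<le> 1 + (u - m) * (v - m) / c" and "1 + (u - m) * (v - m) / c \<le> 5"
proof -
  have "- c \<le> (u - m) * (v - m)"
    using deviation_product_ge[OF assms(2-4)] assms(1) by linarith
  then show "0 \<le> 1 + (u - m) * (v - m) / c"
    using assms(1) by (simp add: field_simps)
  have "\<bar>u - m\<bar> * \<bar>v - m\<bar> \<le> 1 * 1"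
    using assms by (intro mult_mono) auto
  then have "(u - m) * (v - m) \<le> 4 * c"
    using assms(1) abs_ge_self[of "(u - m) * (v - m)"] by (simp add: abs_mult)
  then show "1 + (u - m) * (v - m) / c \<le> 5"
    using assms(1) by (simp add: field_simps)
qed

lemma stopped_capital_bounds:
  assumes "c \<ge> 1 / 4" "m \<in> {0..1}" "\<And>i. 1 \<le> i \<Longrightarrow> x i \<in> {0..1}"
  shows "0 \<le> stopped_capital c m a x n \<and> stopped_capital c m a x n \<le> 5 ^ n"
proof (induction n)
  case (Suc n)
  let ?f = "1 + (running_mean m x n - m) * (x (Suc n) - m) / c"
  have f: "0 \<le> ?f" "?f \<le> 5"
    using capital_factor_bounds[OF assms(1,2) running_mean_in_unit_interval[of m x n] assms(3)[of "Suc n"]]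
      assms(2,3)
    by auto
  then have "stopped_capital c m a x n * ?f \<le> 5 ^ n * 5"
    using Suc.IH by (intro mult_mono) auto
  moreover have "(5::real) ^ n \<le> 5 ^ Suc n" by simp
  ultimately show ?case
    using Suc.IH f by (auto simp: mult.commute intro: order_trans)
qed simp

lemma stopped_bet_bound:
  assumes "c \<ge> 1 / 4" "m \<in> {0..1}" "\<And>i. 1 \<le> i \<Longrightarrow> x i \<in> {0..1}"
  shows "\<bar>stopped_bet c m a x n\<bar> \<le> 5 ^ n / c"
proof -
  have "\<bar>running_mean m x n - m\<bar> \<le> 1"
    using running_mean_in_unit_interval[of m x n] assms(2,3) by auto
  then have "\<bar>stopped_capital c m a x n\<bar> * \<bar>running_mean m x n - m\<bar> \<le> 5 ^ n * 1"
    using stopped_capital_bounds[of c m x a n] assms by (intro mult_mono) auto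
  then show ?thesis
    using assms(1) by (auto simp: stopped_bet_def abs_mult divide_right_mono)
qed

section \<open>Rejection as a level crossing of the stopped capital\<close>

text \<open>Until the first crossing both processes agree; at the crossing the stopped one keeps its
  value forever. By \<open>1 < a\<close> the start value 1 is not yet frozen.\<close>

lemma stopped_capital_cases:
  assumes "1 < a"
  shows "if \<exists>i\<in>{1..n}. a \<le> capital c m x i then a \<le> stopped_capital c m a x n
    else stopped_capital c m a x n = capital c m x n \<and> capital c m x n < a"
proof (induction n)
  case 0
  then show ?case using assms by (simp add: capital_def)
next
  case (Suc n)
  have "capital c m x (Suc n) =
      capital c m x n * (1 + (running_mean m x n - m) * (x (Suc n) - m) / c)"
    by (simp add: capital_def)
  with Suc show ?case
    by (auto simp: atLeastAtMostSuc_conv not_le split: if_splits)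
qed

lemma capital_test_eq_1_iff:
  assumes "0 < \<alpha>" "\<alpha> < 1" "1 \<le> t"
  shows "capital_test c m \<alpha> x t = 1 \<longleftrightarrow> 1 / \<alpha> \<le> stopped_capital c m (1 / \<alpha>) x t"
proof -
  \<comment> \<open>By \<open>1 \<le> t\<close> the maximum ranges over a nonempty set, so it
    reaches the level exactly if some element does.\<close>
  have "capital_test c m \<alpha> x t = 1 \<longleftrightarrow> (\<exists>i\<in>{1..t}. 1 / \<alpha> \<le> capital c m x i)"
    using assms(3) by (auto simp: capital_test_def Max_ge_iff)
  then show ?thesis
    using stopped_capital_cases[of "1 / \<alpha>" t c m x] assms by (auto split: if_splits)
qed

section \<open>Measurability in finitely many coordinates\<close>

lemma running_mean_measurable:
  assumes "n \<le> k"
  shows "(\<lambda>x. running_mean m x n) \<in> borel_measurable (PiM {1..k} (\<lambda>_. borel))"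
proof -
  have "(\<lambda>x. \<Sum>j=1..n. x j) \<in> borel_measurable (PiM {1..k} (\<lambda>_. borel :: real measure))"
    using assms by (intro borel_measurable_sum measurable_component_singleton) auto
  note [measurable] = this
  show ?thesis
    unfolding running_mean_def by measurable
qed

text \<open>The index set \<open>{1..k}\<close> stays fixed while the induction on \<open>n\<close>
  runs, so all steps live on one product space.\<close>

lemma stopped_capital_measurable:
  assumes "n \<le> k"
  shows "(\<lambda>x. stopped_capital c m a x n) \<in> borel_measurable (PiM {1..k} (\<lambda>_. borel))"
  using assms
proof (induction n)
  case (Suc n)
  have [measurable]: "(\<lambda>x. running_mean m x n) \<in> borel_measurable (PiM {1..k} (\<lambda>_. borel))"
    by (rule running_mean_measurable) (use Suc.prems in simp)
  have [measurable]:
    "(\<lambda>x. x (Suc n)) \<in> borel_measurable (PiM {1..k} (\<lambda>_. borel :: real measure))"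
    by (rule measurable_component_singleton) (use Suc.prems in simp)
  have [measurable]: "(\<lambda>x. stopped_capital c m a x n) \<in> borel_measurable (PiM {1..k} (\<lambda>_. borel))"
    using Suc by simp
  show ?case unfolding stopped_capital.simps by measurable
qed simp

lemma stopped_bet_measurable:
  "(\<lambda>x. stopped_bet c m a x n) \<in> borel_measurable (PiM {1..n} (\<lambda>_. borel))"
proof -
  note [measurable] = stopped_capital_measurable[OF order_refl] running_mean_measurable[OF order_refl]
  show ?thesis unfolding stopped_bet_def by measurable
qed

text \<open>Independence of blocks is stated for restricted families, which are
  \<open>undefined\<close> outside \<open>{1..n}\<close>; the bet never looks there.\<close>

lemma stopped_bet_restrict:
  "stopped_bet c m a (restrict x {1..n}) n = stopped_bet c m a x n"
  using stopped_capital_cong[of n "restrict x {1..n}" x]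
    running_mean_cong[of n "restrict x {1..n}" x]
  by (simp add: stopped_bet_def)

lemma stopped_capital_restrict:
  "stopped_capital c m a (restrict x {1..n}) n = stopped_capital c m a x n"
  by (rule stopped_capital_cong) simp

section \<open>Constant expectation and Markov's inequality\<close>

context prob_space
begin

lemma stopped_capital_random_variable:
  assumes "\<And>i. 1 \<le> i \<Longrightarrow> random_variable borel (X i)"
  shows "random_variable borel (\<lambda>\<omega>. stopped_capital c m a (\<lambda>i. X i \<omega>) n)"
proof -
  have "(\<lambda>\<omega>. restrict (\<lambda>i. X i \<omega>) {1..n}) \<in> measurable M (PiM {1..n} (\<lambda>_. borel))"
    using assms by (intro measurable_restrict) auto
  from measurable_compose[OF this stopped_capital_measurable[OF order_refl]]
  show ?thesis by (simp only: stopped_capital_restrict)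
qed

text \<open>The families over the disjoint index sets \<open>{1..n}\<close> and
  \<open>{Suc n}\<close> are independent; the bet and the next deviation are measurable functions of
  them.\<close>

lemma stopped_bet_indep:
  assumes "indep_vars (\<lambda>_. borel) X {1..}"
  shows "indep_var borel (\<lambda>\<omega>. stopped_bet c m a (\<lambda>i. X i \<omega>) n)
    borel (\<lambda>\<omega>. X (Suc n) \<omega> - m)"
proof -
  have "indep_var (PiM {1..n} (\<lambda>_. borel)) (\<lambda>\<omega>. restrict (\<lambda>i. X i \<omega>) {1..n})
      (PiM {Suc n} (\<lambda>_. borel)) (\<lambda>\<omega>. restrict (\<lambda>i. X i \<omega>) {Suc n})"
    by (rule indep_var_restrict[OF assms]) auto
  from indep_var_compose[OF this stopped_bet_measurable[of c m a n], of "\<lambda>x. x (Suc n) - m" borel]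
  show ?thesis by (simp add: comp_def stopped_bet_restrict del: One_nat_def)
qed

text \<open>In place of conditional expectations, independence factors the mean of each increment
  into the mean of the bet times that of \<open>X (Suc n) - m\<close>, which is 0. Almost sure
  boundedness makes both factors integrable.\<close>

lemma expectation_stopped_capital:
  assumes "c \<ge> 1 / 4" "m \<in> {0..1}"
    and indep: "indep_vars (\<lambda>_. borel) X {1..}"
    and range: "AE \<omega> in M. \<forall>i\<ge>1. X i \<omega> \<in> {0..1}"
    and mean: "\<And>i. 1 \<le> i \<Longrightarrow> expectation (X i) = m"
  shows "integrable M (\<lambda>\<omega>. stopped_capital c m a (\<lambda>i. X i \<omega>) n) \<and>
    expectation (\<lambda>\<omega>. stopped_capital c m a (\<lambda>i. X i \<omega>) n) = 1"
proof (induction n)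
  case 0
  then show ?case by (simp add: prob_space)
next
  case (Suc n)
  let ?D = "\<lambda>\<omega>. stopped_bet c m a (\<lambda>i. X i \<omega>) n"
  have rv: "random_variable borel (X (Suc n))"
    using indep by (auto simp: indep_vars_def)
  have intX: "integrable M (X (Suc n))"
    by (rule integrable_const_bound[where B = 1, OF _ rv]) (use range in auto)
  have ind: "indep_var borel ?D borel (\<lambda>\<omega>. X (Suc n) \<omega> - m)"
    by (rule stopped_bet_indep[OF indep])
  have "AE \<omega> in M. norm (?D \<omega>) \<le> 5 ^ n / c"
    using range by eventually_elim (use assms stopped_bet_bound in simp)
  then have intD: "integrable M ?D"
    using indep_var_rv1[OF ind] by (rule integrable_const_bound)
  have intX': "integrable M (\<lambda>\<omega>. X (Suc n) \<omega> - m)"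
    using intX by simp
  have "expectation (\<lambda>\<omega>. X (Suc n) \<omega> - m) = 0"
    using intX mean by (simp add: prob_space)
  then have "expectation (\<lambda>\<omega>. ?D \<omega> * (X (Suc n) \<omega> - m)) = 0"
    using indep_var_lebesgue_integral[OF ind intD intX'] by simp
  with Suc indep_var_integrable[OF ind intD intX'] show ?case
    by (simp only: stopped_capital_Suc_eq Bochner_Integration.integrable_add
        Bochner_Integration.integral_add add_0_right simp_thms)
qed

lemma prob_stopped_capital_le:
  assumes "c \<ge> 1 / 4" "m \<in> {0..1}" "0 < a"
    and indep: "indep_vars (\<lambda>_. borel) X {1..}"
    and range: "AE \<omega> in M. \<forall>i\<ge>1. X i \<omega> \<in> {0..1}"
    and mean: "\<And>i. 1 \<le> i \<Longrightarrow> expectation (X i) = m"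
  shows "prob {\<omega> \<in> space M. a \<le> stopped_capital c m a (\<lambda>i. X i \<omega>) n} \<le> 1 / a"
proof -
  have "AE \<omega> in M. 0 \<le> stopped_capital c m a (\<lambda>i. X i \<omega>) n"
    using range by eventually_elim (use assms(1,2) stopped_capital_bounds in simp)
  then show ?thesis
    using expectation_stopped_capital[OF assms(1,2) indep range mean, of a n] assms(3)
      integral_Markov_inequality_measure
        [of M "\<lambda>\<omega>. stopped_capital c m a (\<lambda>i. X i \<omega>) n" "{}" a]
    by simp
qed

end

theorem theorem1:
  fixes M :: "'a measure" and P :: "real measure" and X :: "nat \<Rightarrow> 'a \<Rightarrow> real"
    and \<alpha> c m :: real
  assumes "0 < \<alpha>" "\<alpha> < 1"
    and "c \<ge> 1 / 4"
    and "0 \<le> m" "m \<le> 1"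
    and "prob_space M"
    and "prob_space P" "sets P = sets borel" "measure P {0..1} = 1"
    and "integral\<^sup>L P (\<lambda>x. x) = m"
    and "prob_space.indep_vars M (\<lambda>_. borel) X {1..}"
    and "\<And>i. i \<ge> 1 \<Longrightarrow> distr M borel (X i) = P"
  shows "measure M {\<omega> \<in> space M. \<exists>t\<ge>1. capital_test c m \<alpha> (\<lambda>i. X i \<omega>) t = 1} \<le> \<alpha>"
proof -
  interpret prob_space M by fact
  interpret P: prob_space P by fact
  let ?E = "\<lambda>t. {\<omega> \<in> space M. 1 / \<alpha> \<le> stopped_capital c m (1 / \<alpha>) (\<lambda>i. X i \<omega>) t}"
  note indep = assms(11)
  have m: "m \<in> {0..1}" and a: "1 < 1 / \<alpha>" using assms(1-5) by auto
  have rv: "random_variable borel (X i)" if "1 \<le> i" for i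
    using indep that by (auto simp: indep_vars_def)
  have "AE y in P. y \<in> {0..1}"
    using assms(8,9) by (intro P.AE_prob_1) simp
  then have "AE \<omega> in M. X i \<omega> \<in> {0..1}" if "1 \<le> i" for i
    using AE_distrD[OF rv[OF that], of "\<lambda>y. y \<in> {0..1}"] assms(12)[OF that] by metis
  \<comment> \<open>The range is known only through the law \<open>P\<close>, hence almost surely;
    countably many indices share one null set.\<close>
  then have range: "AE \<omega> in M. \<forall>i\<ge>1. X i \<omega> \<in> {0..1}"
    by (auto simp: AE_all_countable)
  have mean: "expectation (X i) = m" if "1 \<le> i" for i
    using integral_distr[OF rv[OF that], of "\<lambda>x. x"] assms(10) assms(12)[OF that] by simp
  have bound: "prob (?E t) \<le> \<alpha>" for t
    using prob_stopped_capital_le[OF assms(3) m _ indep range mean, of "1 / \<alpha>" t] assms(1) by simp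
  have "range ?E \<subseteq> events"
    using stopped_capital_random_variable[OF rv] by auto
  \<comment> \<open>A frozen path keeps its value, so \<open>?E t\<close> is contained in
    \<open>?E (Suc t)\<close>.\<close>
  moreover have "incseq ?E"
    by (auto intro!: incseq_SucI)
  ultimately have "(\<lambda>t. prob (?E t)) \<longlonglongrightarrow> prob (\<Union>t. ?E t)"
    by (rule finite_Lim_measure_incseq)
  then have "prob (\<Union>t. ?E t) \<le> \<alpha>"
    using bound by (intro LIMSEQ_le_const2) auto
  moreover have "{\<omega> \<in> space M. \<exists>t\<ge>1. capital_test c m \<alpha> (\<lambda>i. X i \<omega>) t = 1} = (\<Union>t. ?E t)"
  proof -
    \<comment> \<open>At time 0 the stopped capital is \<open>1 < 1 / \<alpha>\<close>, so
      \<open>?E 0\<close> is empty and the union over all \<open>t\<close> is the one over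
      \<open>t \<ge> 1\<close>.\<close>
    have "1 \<le> t" if "1 / \<alpha> \<le> stopped_capital c m (1 / \<alpha>) x t" for t x
      using that a by (cases t) auto
    then show ?thesis
      using capital_test_eq_1_iff[OF assms(1,2)] by blast
  qed
  ultimately show ?thesis by simp
qed

end
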